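(* Let $(X_N)_{N\ge1}$ be a sequence of bounded random variables with values in $\mathbb{N}_0=\{0,1,2,\ldots\}$, with variances $\sigma_N^2>0$ and probability generating functions $f_N(z)=\mathbb{E}[z^{X_N}]$ (which are polynomials). For $N\ge1$ let $\delta_N\in(0,\pi]$ be such that $f_N$ has no roots in the sector $S(\delta_N)$. Put $\Delta_N:=c\,\delta_N\sigma_N$ with the absolute constant $c>0$ of the context, $X_N^\ast:=(X_N-\mathbb{E}X_N)/\sigma_N$ and $\kappa_{m,N}^\ast:=\kappa_m(X_N^\ast)$. Assume $\Delta_N\to\infty$ as $N\to\infty$. (i) If $\kappa_{3,N}^\ast\Delta_N\to L\in\mathbb{R}$ as $N\to\infty$, then the sequence $\Delta_N^{1/3}X_N^\ast$ converges in the mod-Gaussian sense with parameters $\Delta_N^{2/3}$ and limiting function $e^{Lz^3/6}$. (ii) If $\kappa_{3,N}^\ast=0$ for all $N$ and $\kappa_{4,N}^\ast\Delta_N^2\to L\in\mathbb{R}$ as $N\to\infty$, then the sequence $\sqrt{\Delta_N}\,X_N^\ast$ converges in the mod-Gaussian sense with parameters $\Delta_N$ and limiting function $e^{Lz^4/24}$.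
   Context: For $\delta\in(0,\pi]$, $S(\delta):=\{z\in\mathbb{C}\setminus\{0\}:\arg(z)\in(-\delta,\delta)\}$, where $\arg(z)\in(-\pi,\pi]$. The cumulant of order $m$ of a random variable $X$ is denoted $\kappa_m(X)$. The constant $c>0$ is a fixed absolute constant with the following property (such a constant exists, and $c=2^{-3248}$ is admissible): for every bounded $\mathbb{N}_0$-valued random variable $X$ with variance $\sigma^2>0$ whose probability generating function has no roots in $S(\delta)$, where $\delta\in(0,\pi]$, one has $|\kappa_m((X-\mathbb{E}X)/\sigma)|\le m!/(c\,\delta\,\sigma)^{m-2}$ for all integers $m\ge3$. Mod-Gaussian convergence: a sequence of random variables $Y_N$ converges in the mod-Gaussian sense with parameters $t_N\to\infty$ and limiting function $\Psi$ if $\lim_{N\to\infty}\mathbb{E}[e^{zY_N}]e^{-t_Nz^2/2}=\Psi(z)$ locally uniformly on $\mathbb{C}$, where $\Psi$ is a non-degenerate analytic function. *)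

theory Defs
  imports "HOL-Probability.Probability"
begin

definition bounded_nat_rv :: "'a measure \<Rightarrow> ('a \<Rightarrow> nat) \<Rightarrow> bool" where
  "bounded_nat_rv M X \<longleftrightarrow>
     prob_space M \<and> X \<in> measurable M (count_space UNIV) \<and> (\<exists>B. AE \<omega> in M. X \<omega> \<le> B)"

definition std_dev :: "'a measure \<Rightarrow> ('a \<Rightarrow> nat) \<Rightarrow> real" where
  "std_dev M X = sqrt (prob_space.variance M (\<lambda>\<omega>. real (X \<omega>)))"

definition standardized :: "'a measure \<Rightarrow> ('a \<Rightarrow> nat) \<Rightarrow> 'a \<Rightarrow> real" where
  "standardized M X \<omega> =
     (real (X \<omega>) - prob_space.expectation M (\<lambda>\<omega>. real (X \<omega>))) / std_dev M X"

definition pgf :: "'a measure \<Rightarrow> ('a \<Rightarrow> nat) \<Rightarrow> complex \<Rightarrow> complex" where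
  "pgf M X z = prob_space.expectation M (\<lambda>\<omega>. z ^ X \<omega>)"

definition mgf :: "'a measure \<Rightarrow> ('a \<Rightarrow> real) \<Rightarrow> complex \<Rightarrow> complex" where
  "mgf M Y z = prob_space.expectation M (\<lambda>\<omega>. exp (z * of_real (Y \<omega>)))"

text \<open>Cumulants are the derivatives at 0 of the logarithm of the moment generating function on
  the real line. This is meant for variables whose moment generating function is finite near 0,
  in particular for bounded ones.\<close>

definition cumulant :: "nat \<Rightarrow> 'a measure \<Rightarrow> ('a \<Rightarrow> real) \<Rightarrow> real" where
  "cumulant m M Y =
     (deriv ^^ m) (\<lambda>t::real. ln (prob_space.expectation M (\<lambda>\<omega>. exp (t * Y \<omega>)))) 0"

definition sector :: "real \<Rightarrow> complex set" where
  "sector \<delta> = {z. z \<noteq> 0 \<and> Arg z \<in> {-\<delta><..<\<delta>}}"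

text \<open>The absolute constants for which the cumulant bound holds. HOL cannot quantify over all
  types of sample spaces inside a formula; sample spaces of type \<open>nat\<close> are no restriction,
  because the condition only involves the law of \<open>X\<close>, and every law on the natural numbers is
  realized by the identity on such a space.\<close>

definition cumulant_bound_constant :: "real \<Rightarrow> bool" where
  "cumulant_bound_constant c \<longleftrightarrow>
     c > 0 \<and>
     (\<forall>(M :: nat measure) X \<delta> m.
        bounded_nat_rv M X \<longrightarrow> prob_space.variance M (\<lambda>\<omega>. real (X \<omega>)) > 0 \<longrightarrow>
        0 < \<delta> \<longrightarrow> \<delta> \<le> pi \<longrightarrow> (\<forall>z\<in>sector \<delta>. pgf M X z \<noteq> 0) \<longrightarrow> m \<ge> 3 \<longrightarrow>
        \<bar>cumulant m M (standardized M X)\<bar> \<le> fact m / (c * \<delta> * std_dev M X) ^ (m - 2))"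

text \<open>Sequences are indexed by \<open>N \<ge> 1\<close>. Integrability is required explicitly because the
  Bochner integral of a non-integrable function is 0. As usual in the theory of mod-phi
  convergence, the limiting function is non-degenerate if it has no zeros on the real axis;
  in particular it is then not identically zero.\<close>

definition mod_gaussian_convergence ::
  "(nat \<Rightarrow> 'a measure) \<Rightarrow> (nat \<Rightarrow> 'a \<Rightarrow> real) \<Rightarrow> (nat \<Rightarrow> real) \<Rightarrow> (complex \<Rightarrow> complex) \<Rightarrow> bool" where
  "mod_gaussian_convergence M Y t \<Psi> \<longleftrightarrow>
     filterlim t at_top sequentially \<and>
     \<Psi> analytic_on UNIV \<and> (\<forall>x::real. \<Psi> (of_real x) \<noteq> 0) \<and>
     (\<forall>N\<ge>1. \<forall>z::complex. integrable (M N) (\<lambda>\<omega>. exp (z * of_real (Y N \<omega>)))) \<and>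
     (\<forall>z0. \<exists>r>0. uniform_limit (ball z0 r)
        (\<lambda>N z. mgf (M N) (Y N) z * exp (- of_real (t N) * z\<^sup>2 / 2)) \<Psi> sequentially)"

end

theory Submission
  imports Defs "HOL-Complex_Analysis.Complex_Analysis" "HOL-Real_Asymp.Real_Asymp"
begin

text \<open>
  The cumulant bound makes the cumulant series \<open>\<Sum> \<kappa>\<^sub>m z^m / m!\<close> of \<open>X\<^sub>N\<^sup>*\<close>
  converge for \<open>\<bar>z\<bar> < \<Delta>\<^sub>N\<close>. Its exponential agrees with the entire moment generating
  function near 0, hence on the whole disc by the identity theorem; that the moment generating
  function has no zeros there need not be known in advance. After rescaling by
  \<open>s = \<Delta>\<^sub>N powr (1/3)\<close> (resp. \<open>s = sqrt \<Delta>\<^sub>N\<close>) the quadratic term cancels the Gaussian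
  factor, the next non-vanishing term converges by assumption, and the tail from order \<open>k\<close> on
  (\<open>k = 4\<close>, resp. \<open>k = 5\<close>) is dominated by a geometric series of size
  \<open>\<Delta>\<^sub>N\<^sup>2 (\<bar>z\<bar> s / \<Delta>\<^sub>N)^k\<close>, which tends to 0.
\<close>

section \<open>The cumulant series and the moment generating function\<close>

text \<open>Links \<open>cumulant\<close>, defined by real derivatives, with the Taylor coefficients
  of a holomorphic logarithm. The complex derivative can be computed along the real axis, where the
  values are real, so it is real too and agrees with the real derivative.\<close>

lemma higher_deriv_of_real:
  fixes g :: "complex \<Rightarrow> complex" and f :: "real \<Rightarrow> real"
  assumes "g holomorphic_on U" "open U" "\<And>t. complex_of_real t \<in> U"
    and "\<And>t. g (of_real t) = of_real (f t)"
  shows "(deriv ^^ m) g (of_real t) = of_real ((deriv ^^ m) f t)"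
proof (induction m arbitrary: t)
  case 0
  then show ?case using assms by simp
next
  case (Suc m)
  define G where "G = (deriv ^^ m) g"
  define h where "h = (deriv ^^ m) f"
  define D where "D = deriv G (of_real t)"
  have "G holomorphic_on U"
    unfolding G_def using assms by (intro holomorphic_higher_deriv)
  then have "(G has_field_derivative D) (at (of_real t))"
    unfolding D_def using assms by (intro holomorphic_derivI) auto
  then have "((\<lambda>t. G (of_real t)) has_vector_derivative D) (at t)"
    by (rule has_vector_derivative_real_field)
  moreover have "(\<lambda>t. G (of_real t)) = (\<lambda>t. of_real (h t))"
    using Suc by (simp add: G_def h_def)
  ultimately have D: "((\<lambda>t. complex_of_real (h t)) has_vector_derivative D) (at t)"
    by simp
  \<comment> \<open>Taking real parts shows that \<open>h\<close> is differentiable; embedding its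
    derivative back gives a second vector derivative of the same curve, and uniqueness forces
    \<open>D\<close> to be real.\<close>
  then have "((\<lambda>t. Re (complex_of_real (h t))) has_vector_derivative Re D) (at t)"
    by (rule bounded_linear.has_vector_derivative[OF bounded_linear_Re])
  then have h: "(h has_real_derivative Re D) (at t)"
    by (simp add: has_real_derivative_iff_has_vector_derivative)
  then have "((\<lambda>t. complex_of_real (h t)) has_vector_derivative of_real (Re D)) (at t)"
    by (intro has_vector_derivative_of_real)
       (auto simp: has_real_derivative_iff_has_vector_derivative)
  with D have "D = of_real (Re D)"
    using vector_derivative_unique_at by blast
  with DERIV_imp_deriv[OF h] show ?case
    by (simp add: D_def G_def h_def)
qed

text \<open>The law has finite support here, with weights \<open>p\<close> and values
  \<open>x\<close>, so that the moment generating function is a finite exponential sum and therefore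
  entire. Mean 0 and second moment 1 fix the first two cumulants through the derivatives of
  \<open>Ln\<close> of this sum at 0.\<close>

lemma exp_sum_eq_exp_cumulant_series:
  fixes I :: "'i set" and p x :: "'i \<Rightarrow> real" and \<Delta> :: real
  defines "\<kappa> \<equiv> (\<lambda>m. (deriv ^^ m) (\<lambda>t::real. ln (\<Sum>k\<in>I. p k * exp (t * x k))) 0)"
  assumes "finite I" and p0: "\<And>k. k \<in> I \<Longrightarrow> 0 \<le> p k" and p1: "sum p I = 1"
    and mean: "(\<Sum>k\<in>I. p k * x k) = 0" and var: "(\<Sum>k\<in>I. p k * (x k)\<^sup>2) = 1"
    and \<Delta>: "\<Delta> > 0" and bound: "\<And>m. m \<ge> 3 \<Longrightarrow> \<bar>\<kappa> m\<bar> \<le> fact m / \<Delta> ^ (m - 2)"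
  shows "\<kappa> 0 = 0" and "\<kappa> 1 = 0" and "\<kappa> 2 = 1"
    and "\<And>z::complex. norm z < \<Delta> \<Longrightarrow> summable (\<lambda>m. of_real (\<kappa> m / fact m) * z ^ m)"
    and "\<And>z::complex. norm z < \<Delta> \<Longrightarrow> (\<Sum>k\<in>I. of_real (p k) * exp (z * of_real (x k))) =
           exp (\<Sum>m. of_real (\<kappa> m / fact m) * z ^ m)"
proof -
  define F where "F = (\<lambda>z::complex. \<Sum>k\<in>I. of_real (p k) * exp (z * of_real (x k)))"
  define F1 where "F1 = (\<lambda>z::complex. \<Sum>k\<in>I. of_real (p k * x k) * exp (z * of_real (x k)))"
  define F2 where "F2 = (\<lambda>z::complex. \<Sum>k\<in>I. of_real (p k * (x k)\<^sup>2) * exp (z * of_real (x k)))"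
  define Fr where "Fr = (\<lambda>t::real. \<Sum>k\<in>I. p k * exp (t * x k))"
  \<comment> \<open>On \<open>U\<close> the function \<open>F\<close> avoids the branch cut of
    \<open>Ln\<close>. The whole real axis lies in \<open>U\<close> because \<open>F\<close> is
    positive there.\<close>
  define U where "U = F -` (- \<real>\<^sub>\<le>\<^sub>0)"
  define g where "g = (\<lambda>z. Ln (F z))"
  have dF: "(F has_field_derivative F1 z) (at z)" for z
    unfolding F_def F1_def by (auto intro!: derivative_eq_intros sum.cong)
  have dF1: "(F1 has_field_derivative F2 z) (at z)" for z
    unfolding F1_def F2_def
    by (auto intro!: derivative_eq_intros sum.cong simp: power2_eq_square)
  have holF: "F holomorphic_on A" for A
    unfolding F_def by (intro holomorphic_intros)
  have F0: "F 0 = 1" "F1 0 = 0" "F2 0 = 1"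
    using p1 mean var unfolding F_def F1_def F2_def
    by (simp_all flip: of_real_sum of_real_mult of_real_power)
  have Fr_pos: "Fr t > 0" for t
  proof -
    obtain k where "k \<in> I" "p k \<noteq> 0"
      using p1 by (metis sum.neutral zero_neq_one)
    then show ?thesis
      unfolding Fr_def using \<open>finite I\<close> p0
      by (intro sum_pos2[of I k]) (auto simp: less_le)
  qed
  have F_real: "F (of_real t) = of_real (Fr t)" for t
    unfolding F_def Fr_def by (simp flip: exp_of_real)
  have openU: "open U"
    unfolding U_def using holomorphic_on_imp_continuous_on[OF holF[of UNIV]]
    by (intro open_vimage) (auto simp: closed_nonpos_Reals_complex)
  have realU: "of_real t \<in> U" for t
    using Fr_pos[of t] by (auto simp: U_def F_real not_le)
  have holg: "g holomorphic_on U"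
    unfolding g_def by (intro holomorphic_on_Ln' holF) (auto simp: U_def)
  have g_real: "g (of_real t) = of_real (ln (Fr t))" for t
    unfolding g_def F_real using Fr_pos[of t] by (simp add: Ln_of_real)
  have \<kappa>: "of_real (\<kappa> m) = (deriv ^^ m) g 0" for m
    using higher_deriv_of_real[OF holg openU realU g_real, of m 0]
    unfolding \<kappa>_def Fr_def by simp
  have dg: "(g has_field_derivative F1 z / F z) (at z)" if "z \<in> U" for z
    unfolding g_def using that
    by (auto intro!: derivative_eq_intros dF simp: U_def divide_inverse mult.commute)
  have U0: "0 \<in> U" using realU[of 0] by simp
  show "\<kappa> 0 = 0"
    using \<kappa>[of 0] by (simp add: g_def F0)
  show "\<kappa> 1 = 0"
    using \<kappa>[of 1] DERIV_imp_deriv[OF dg[OF U0]] by (simp add: F0)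
  \<comment> \<open>The quotient formula for the derivative of \<open>g\<close> holds on a
    neighbourhood of 0, so it may be differentiated again; at 0 the quotient rule gives (1 * 1 - 0 *
    0) / 1 = 1.\<close>
  have "deriv (deriv g) 0 = deriv (\<lambda>z. F1 z / F z) 0"
    using eventually_nhds_in_open[OF openU U0]
    by (intro deriv_cong_ev refl) (auto elim!: eventually_mono intro: DERIV_imp_deriv dg)
  also have "((\<lambda>z. F1 z / F z) has_field_derivative 1) (at 0)"
    using DERIV_divide[OF dF1[of 0] dF[of 0]] by (simp add: F0)
  note DERIV_imp_deriv[OF this]
  finally show "\<kappa> 2 = 1"
    using \<kappa>[of 2] by (simp add: numeral_2_eq_2)
  show sm: "summable (\<lambda>m. of_real (\<kappa> m / fact m) * z ^ m)" if z: "norm z < \<Delta>" for z :: complex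
  proof (rule summable_comparison_test')
    \<comment> \<open>Since \<open>1 / \<Delta> ^ (m - 2) = \<Delta>\<^sup>2 / \<Delta> ^ m\<close>,
      the terms from order 3 on have a geometric majorant.\<close>
    show "summable (\<lambda>m. \<Delta>\<^sup>2 * (norm z / \<Delta>) ^ m)"
      using z \<Delta> by (intro summable_mult summable_geometric) auto
    show "norm (of_real (\<kappa> m / fact m) * z ^ m) \<le> \<Delta>\<^sup>2 * (norm z / \<Delta>) ^ m" if "m \<ge> 3" for m
    proof -
      have "\<bar>\<kappa> m\<bar> / fact m * norm z ^ m \<le> (1 / \<Delta> ^ (m - 2)) * norm z ^ m"
        using bound[OF that] by (intro mult_right_mono) (auto simp: field_simps)
      also have "1 / \<Delta> ^ (m - 2) = \<Delta>\<^sup>2 / \<Delta> ^ m"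
        using that \<Delta> by (simp add: power_diff)
      finally show ?thesis
        by (simp add: norm_mult norm_power norm_divide power_divide)
    qed
  qed
  define h where "h = (\<lambda>z::complex. \<Sum>m. of_real (\<kappa> m / fact m) * z ^ m)"
  obtain e where e: "e > 0" "ball 0 e \<subseteq> U"
    using openU U0 open_contains_ball by blast
  \<comment> \<open>Radius \<open>e\<close> makes the Taylor series of \<open>g\<close> converge to
    \<open>g\<close>; radius \<open>\<Delta>\<close> keeps \<open>S\<close> inside the disc of the
    continuation.\<close>
  define S where "S = ball (0::complex) (min e \<Delta>)"
  have "h holomorphic_on ball 0 \<Delta>"
    by (rule power_series_holomorphic[where a = "\<lambda>m. of_real (\<kappa> m / fact m)"])
       (use sm in \<open>auto simp: h_def intro!: summable_sums\<close>)
  then have hol: "(\<lambda>z. exp (h z)) holomorphic_on ball 0 \<Delta>"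
    by (intro holomorphic_intros)
  have eq: "F z = exp (h z)" if z: "z \<in> S" for z
  proof -
    have "g holomorphic_on ball 0 e"
      using holg e holomorphic_on_subset by blast
    moreover have "z \<in> ball 0 e" using z by (simp add: S_def)
    ultimately have "(\<lambda>n. (deriv ^^ n) g 0 / fact n * (z - 0) ^ n) sums g z"
      by (rule holomorphic_power_series)
    then have "h z = g z"
      unfolding h_def by (simp add: \<kappa> sums_iff)
    moreover have "F z \<noteq> 0"
      using z e by (auto simp: S_def U_def)
    ultimately show ?thesis by (simp add: g_def)
  qed
  show "F z = exp (h z)" if "norm z < \<Delta>" for z
  proof (rule analytic_continuation_open[of S "ball 0 \<Delta>" F "\<lambda>z. exp (h z)"])
    show "F holomorphic_on ball 0 \<Delta>" by (rule holF)
    show "(\<lambda>z. exp (h z)) holomorphic_on ball 0 \<Delta>" by (rule hol)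
    show "S \<noteq> {}" using e \<Delta> by (simp add: S_def)
    show "F z = exp (h z)" if "z \<in> S" for z using that by (rule eq)
    show "z \<in> ball 0 \<Delta>" using that by simp
  qed (auto simp: S_def)
qed

section \<open>Uniform convergence of the rescaled series\<close>

text \<open>The tail from order \<open>k\<close> on is dominated by a geometric series. It serves
  below with \<open>C = \<Delta>\<^sup>2\<close>, the form that the cumulant bound takes for
  \<open>\<kappa> m / fact m\<close>.\<close>

lemma power_series_remainder_bound:
  fixes a :: "nat \<Rightarrow> complex" and \<Delta> :: real
  assumes "norm w < \<Delta>" and "\<And>m. m \<ge> k \<Longrightarrow> norm (a m) \<le> C / \<Delta> ^ m"
  shows "norm ((\<Sum>m. a m * w ^ m) - (\<Sum>m<k. a m * w ^ m)) \<le>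
           C * (norm w / \<Delta>) ^ k / (1 - norm w / \<Delta>)"
proof -
  define q where "q = norm w / \<Delta>"
  have \<Delta>: "\<Delta> > 0" using assms(1) norm_ge_zero[of w] by linarith
  have q: "0 \<le> q" "q < 1" using assms \<Delta> by (auto simp: q_def)
  have b: "norm (a m * w ^ m) \<le> C * q ^ m" if "m \<ge> k" for m
    using mult_right_mono[OF assms(2)[OF that], of "norm w ^ m"]
    by (simp add: norm_mult norm_power q_def power_divide)
  have gs: "summable (\<lambda>m. C * q ^ m)"
    using q by (intro summable_mult summable_geometric) auto
  have "summable (\<lambda>m. a m * w ^ m)"
    using b by (intro summable_comparison_test'[OF gs]) auto
  then have "(\<Sum>m. a m * w ^ m) - (\<Sum>m<k. a m * w ^ m) = (\<Sum>m. a (m + k) * w ^ (m + k))"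
    by (subst suminf_minus_initial_segment) auto
  also have "norm \<dots> \<le> (\<Sum>m. C * q ^ (m + k))"
    using b summable_ignore_initial_segment[OF gs, of k] by (intro norm_suminf_le) auto
  also have "(\<Sum>m. C * q ^ (m + k)) = C * q ^ k * (\<Sum>m. q ^ m)"
    using suminf_mult[OF summable_geometric[of q], of "C * q ^ k"] q
    by (simp add: power_add mult_ac)
  finally show ?thesis
    using q by (simp add: suminf_geometric q_def)
qed

text \<open>Treats both cases at once: \<open>j\<close> is the order of the first cumulant after the
  variance that may survive. \<open>lim0\<close> brings any fixed ball, after scaling by
  \<open>s N\<close>, into the disc where the series represents \<open>G N\<close>;
  \<open>lim1\<close> removes the tail beyond order \<open>j\<close>.\<close>

lemma uniform_limit_scaled_exp_series:
  fixes \<kappa> :: "nat \<Rightarrow> nat \<Rightarrow> real" and G :: "nat \<Rightarrow> complex \<Rightarrow> complex" and s \<Delta> :: "nat \<Rightarrow> real"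
  assumes G: "\<And>N z. N \<ge> 1 \<Longrightarrow> norm z < \<Delta> N \<Longrightarrow>
                G N z = exp (\<Sum>m. of_real (\<kappa> N m / fact m) * z ^ m)"
    and \<kappa>012: "\<And>N. N \<ge> 1 \<Longrightarrow> \<kappa> N 0 = 0" "\<And>N. N \<ge> 1 \<Longrightarrow> \<kappa> N 1 = 0" "\<And>N. N \<ge> 1 \<Longrightarrow> \<kappa> N 2 = 1"
    and bound: "\<And>N m. N \<ge> 1 \<Longrightarrow> m \<ge> 3 \<Longrightarrow> \<bar>\<kappa> N m\<bar> \<le> fact m / \<Delta> N ^ (m - 2)"
    and j: "j \<ge> 3" and vanish: "\<And>N m. N \<ge> 1 \<Longrightarrow> 3 \<le> m \<Longrightarrow> m < j \<Longrightarrow> \<kappa> N m = 0"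
    and L: "(\<lambda>N. \<kappa> N j * s N ^ j) \<longlonglongrightarrow> L"
    and pos: "\<And>N. N \<ge> 1 \<Longrightarrow> \<Delta> N > 0" "\<And>N. N \<ge> 1 \<Longrightarrow> s N \<ge> 0"
    and lim0: "(\<lambda>N. s N / \<Delta> N) \<longlonglongrightarrow> 0"
    and lim1: "(\<lambda>N. (\<Delta> N)\<^sup>2 * (s N / \<Delta> N) ^ Suc j) \<longlonglongrightarrow> 0"
  shows "uniform_limit (ball z0 r)
           (\<lambda>N z. G N (z * of_real (s N)) * exp (- of_real ((s N)\<^sup>2) * z\<^sup>2 / 2))
           (\<lambda>z. exp (of_real L * z ^ j / fact j)) sequentially"
proof -
  \<comment> \<open>A bound for \<open>norm z\<close> on the ball; the absolute value keeps it
    nonnegative for every \<open>r\<close>.\<close>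
  define R where "R = norm z0 + \<bar>r\<bar>"
  have R: "norm z \<le> R" if "z \<in> ball z0 r" for z
    using that norm_triangle_ineq2[of z z0] by (auto simp: R_def dist_norm norm_minus_commute)
  have R0: "R \<ge> 0" by (simp add: R_def)
  define e where "e = (\<lambda>N z. (\<Sum>m. of_real (\<kappa> N m / fact m) * (z * of_real (s N)) ^ m)
                          - of_real ((s N)\<^sup>2) * z\<^sup>2 / 2 :: complex)"
  define l where "l = (\<lambda>z::complex. of_real L * z ^ j / fact j)"
  \<comment> \<open>An error bound free of \<open>z\<close>: the geometric tail from order
    \<open>Suc j\<close> on, plus the deviation of the coefficient of order \<open>j\<close> from
    its limit.\<close>
  define b where "b = (\<lambda>N. (\<Delta> N)\<^sup>2 * (R * s N / \<Delta> N) ^ Suc j / (1 - R * s N / \<Delta> N)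
                         + \<bar>\<kappa> N j * s N ^ j - L\<bar> * R ^ j / fact j)"
  have lim0': "(\<lambda>N. R * s N / \<Delta> N) \<longlonglongrightarrow> 0"
    using tendsto_mult_left[OF lim0, of R] by simp
  have good: "\<forall>\<^sub>F N in sequentially. N \<ge> 1 \<and> R * s N / \<Delta> N < 1"
    using order_tendstoD(2)[OF lim0', of 1] eventually_ge_at_top[of 1] by (auto intro: eventually_conj)
  \<comment> \<open>The power of \<open>R\<close> is pulled out of the tail so that
    \<open>lim1\<close> applies as it stands.\<close>
  have "(\<lambda>N. R ^ Suc j * ((\<Delta> N)\<^sup>2 * (s N / \<Delta> N) ^ Suc j) / (1 - R * s N / \<Delta> N)
                         + \<bar>\<kappa> N j * s N ^ j - L\<bar> * R ^ j / fact j) \<longlonglongrightarrow>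
        R ^ Suc j * 0 / (1 - 0) + \<bar>L - L\<bar> * R ^ j / fact j"
    by (intro tendsto_intros lim0' lim1 L) auto
  then have b0: "b \<longlonglongrightarrow> 0"
    by (simp add: b_def power_mult_distrib power_divide mult_ac)
  have small: "norm (z * of_real (s N)) \<le> R * s N" "norm (z * of_real (s N)) < \<Delta> N"
    if N: "N \<ge> 1" "R * s N / \<Delta> N < 1" and z: "z \<in> ball z0 r" for N z
  proof -
    show "norm (z * of_real (s N)) \<le> R * s N"
      using R[OF z] pos(2)[OF N(1)] by (simp add: norm_mult mult_right_mono)
    also have "\<dots> < \<Delta> N" using N pos(1)[OF N(1)] by simp
    finally show "norm (z * of_real (s N)) < \<Delta> N" .
  qed
  have e_bound: "dist (e N z) (l z) \<le> b N"
    if N: "N \<ge> 1" "R * s N / \<Delta> N < 1" and z: "z \<in> ball z0 r" for N z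
  proof -
    define w where "w = z * of_real (s N)"
    define a where "a = (\<lambda>m. complex_of_real (\<kappa> N m / fact m))"
    note sm = small[OF N z, folded w_def]
    note pos = pos[OF N(1)]
    have w: "norm w < \<Delta> N" "norm w / \<Delta> N \<le> R * s N / \<Delta> N"
      using sm pos by (auto intro!: divide_right_mono simp: less_imp_le)
    have a: "norm (a m) \<le> (\<Delta> N)\<^sup>2 / \<Delta> N ^ m" if "m \<ge> Suc j" for m
    proof -
      have "norm (a m) \<le> 1 / \<Delta> N ^ (m - 2)"
        using divide_right_mono[OF bound[OF N(1), of m], of "fact m"] that j
        by (simp add: a_def norm_divide)
      also have "\<dots> = (\<Delta> N)\<^sup>2 / \<Delta> N ^ m"
        using that j pos by (simp add: power_diff)
      finally show ?thesis .
    qed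
    \<comment> \<open>Orders 0 and 1 vanish by standardization and orders strictly between 2 and
      \<open>j\<close> by \<open>vanish\<close>.\<close>
    have "(\<Sum>m<Suc j. a m * w ^ m) = (\<Sum>m\<in>{2,j}. a m * w ^ m)"
    proof (intro sum.mono_neutral_right ballI)
      fix m assume m: "m \<in> {..<Suc j} - {2, j}"
      then consider "m = 0" | "m = 1" | "3 \<le> m" "m < j" by force
      then show "a m * w ^ m = 0"
        using \<kappa>012[OF N(1)] vanish[OF N(1)] by cases (auto simp: a_def)
    qed (use j in auto)
    \<comment> \<open>As the second cumulant is 1, the quadratic term is exactly what
      \<open>e\<close> subtracts.\<close>
    also have "\<dots> = of_real ((s N)\<^sup>2) * z\<^sup>2 / 2 + of_real (\<kappa> N j * s N ^ j) * z ^ j / fact j"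
      using j \<kappa>012(3)[OF N(1)] by (simp add: a_def w_def power_mult_distrib mult_ac)
    finally have head: "(\<Sum>m<Suc j. a m * w ^ m) = \<dots>" .
    have "e N z - l z = ((\<Sum>m. a m * w ^ m) - (\<Sum>m<Suc j. a m * w ^ m))
                        + of_real (\<kappa> N j * s N ^ j - L) * z ^ j / fact j"
      unfolding head by (simp add: e_def l_def a_def w_def diff_divide_distrib ring_distribs)
    also have "norm \<dots> \<le> norm ((\<Sum>m. a m * w ^ m) - (\<Sum>m<Suc j. a m * w ^ m))
                  + norm (of_real (\<kappa> N j * s N ^ j - L) * z ^ j / fact j)"
      by (rule norm_triangle_ineq)
    also have "\<dots> \<le> (\<Delta> N)\<^sup>2 * (norm w / \<Delta> N) ^ Suc j / (1 - norm w / \<Delta> N)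
                  + \<bar>\<kappa> N j * s N ^ j - L\<bar> * norm z ^ j / fact j"
      using power_series_remainder_bound[of w "\<Delta> N" "Suc j" a "(\<Delta> N)\<^sup>2", OF w(1) a]
      by (intro add_mono) (simp_all add: norm_mult norm_divide norm_power del: of_real_diff)
    \<comment> \<open>Replacing \<open>norm w\<close> by \<open>R * s N\<close> enlarges the
      numerator and shrinks the denominator, which stays positive by the choice of
      \<open>N\<close>.\<close>
    also have "\<dots> \<le> b N"
      unfolding b_def
      by (intro add_mono frac_le mult_mono power_mono divide_right_mono)
         (use w sm(1) pos N R[OF z] R0 in \<open>auto simp: less_imp_le\<close>)
    finally show ?thesis by (simp add: dist_norm)
  qed
  have ul: "uniform_limit (ball z0 r) e l sequentially"
  proof (rule uniform_limitI)
    fix \<epsilon> :: real assume "\<epsilon> > 0"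
    then have "\<forall>\<^sub>F N in sequentially. b N < \<epsilon>" by (rule order_tendstoD(2)[OF b0])
    with good show "\<forall>\<^sub>F N in sequentially. \<forall>z\<in>ball z0 r. dist (e N z) (l z) < \<epsilon>"
      by eventually_elim (use e_bound le_less_trans in blast)
  qed
  \<comment> \<open>The exponential is uniformly continuous only on bounded sets. On the ball
    \<open>l\<close> is bounded by the radius of \<open>B\<close> minus 1, and \<open>e N\<close> is
    eventually within distance 1 of \<open>l\<close>.\<close>
  define B where "B = cball (0::complex) (\<bar>L\<bar> * R ^ j / fact j + 1)"
  have lim_exp: "uniform_limit (ball z0 r) (\<lambda>N z. exp (e N z)) (\<lambda>z. exp (l z)) sequentially"
  proof (rule uniform_limit_compose_uniformly_continuous_on[OF ul])
    show "uniformly_continuous_on B exp"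
      unfolding B_def by (intro compact_uniformly_continuous continuous_intros) auto
    show "\<forall>\<^sub>F N in sequentially. \<forall>z\<in>ball z0 r. e N z \<in> B"
      using uniform_limitD[OF ul zero_less_one]
    proof eventually_elim
      case (elim N)
      show ?case
      proof
        fix z assume z: "z \<in> ball z0 r"
        have "norm (l z) \<le> \<bar>L\<bar> * R ^ j / fact j"
          using R[OF z] by (auto simp: l_def norm_mult norm_divide norm_power
              intro!: divide_right_mono mult_left_mono power_mono)
        moreover have "norm (e N z - l z) < 1" using elim z by (simp add: dist_norm)
        ultimately show "e N z \<in> B"
          using norm_triangle_ineq2[of "e N z" "l z"] by (simp add: B_def)
      qed
    qed
  qed (simp add: B_def)
  have "\<forall>\<^sub>F N in sequentially. \<forall>z\<in>ball z0 r. exp (e N z) =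
      G N (z * of_real (s N)) * exp (- of_real ((s N)\<^sup>2) * z\<^sup>2 / 2)"
    using good
  proof eventually_elim
    case (elim N)
    show ?case
    proof
      fix z assume "z \<in> ball z0 r"
      with elim have "norm (z * of_real (s N)) < \<Delta> N" by (intro small) auto
      then show "exp (e N z) = G N (z * of_real (s N)) * exp (- of_real ((s N)\<^sup>2) * z\<^sup>2 / 2)"
        using elim G[of N "z * of_real (s N)"] by (simp add: e_def flip: exp_add)
    qed
  qed
  from iffD1[OF uniform_limit_cong[OF this refl] lim_exp] show ?thesis
    by (simp only: l_def)
qed

section \<open>Bounded integer-valued random variables as finite sums\<close>

text \<open>Almost surely \<open>g (X \<omega>)\<close> is a finite combination of indicators of the
  events \<open>X \<omega> = k\<close>. The form \<open>has_bochner_integral\<close> provides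
  integrability and value together.\<close>

lemma has_bochner_integral_bounded_nat_rv:
  fixes g :: "nat \<Rightarrow> 'b :: {banach, second_countable_topology}"
  assumes "prob_space M" and X [measurable]: "X \<in> measurable M (count_space UNIV)"
    and B: "AE \<omega> in M. X \<omega> \<le> B"
  shows "has_bochner_integral M (\<lambda>\<omega>. g (X \<omega>)) (\<Sum>k\<le>B. measure M {\<omega> \<in> space M. X \<omega> = k} *\<^sub>R g k)"
proof -
  interpret prob_space M by fact
  have "has_bochner_integral M (\<lambda>\<omega>. \<Sum>k\<le>B. indicator {\<omega> \<in> space M. X \<omega> = k} \<omega> *\<^sub>R g k)
          (\<Sum>k\<le>B. measure M {\<omega> \<in> space M. X \<omega> = k} *\<^sub>R g k)"
    by (intro has_bochner_integral_sum has_bochner_integral_scaleR_left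
        has_bochner_integral_real_indicator) (auto simp: emeasure_eq_measure)
  moreover have "AE \<omega> in M. (\<Sum>k\<le>B. indicator {\<omega> \<in> space M. X \<omega> = k} \<omega> *\<^sub>R g k) = g (X \<omega>)"
    using B AE_space
  proof eventually_elim
    case (elim \<omega>)
    have "(\<Sum>k\<le>B. indicator {\<omega> \<in> space M. X \<omega> = k} \<omega> *\<^sub>R g k) = (\<Sum>k\<le>B. if k = X \<omega> then g k else 0)"
      using elim by (intro sum.cong) (auto simp: indicator_def)
    also have "\<dots> = g (X \<omega>)" using elim by simp
    finally show ?case .
  qed
  ultimately show ?thesis
    by (subst (asm) has_bochner_integral_cong_AE) auto
qed

text \<open>The property of \<open>c\<close> speaks of sample spaces of type \<open>nat\<close>
  only. All quantities involved are integrals of functions of \<open>X\<close>, so they are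
  unchanged when \<open>X\<close> is replaced by the identity under its law
  \<open>D\<close>.\<close>

lemma cumulant_bound_any_sample_space:
  fixes M :: "'a measure"
  assumes c: "cumulant_bound_constant c" and X: "bounded_nat_rv M X"
    and var: "prob_space.variance M (\<lambda>\<omega>. real (X \<omega>)) > 0" and \<delta>: "0 < \<delta>" "\<delta> \<le> pi"
    and nz: "\<And>z. z \<in> sector \<delta> \<Longrightarrow> pgf M X z \<noteq> 0" and m: "m \<ge> 3"
  shows "\<bar>cumulant m M (standardized M X)\<bar> \<le> fact m / (c * \<delta> * std_dev M X) ^ (m - 2)"
proof -
  interpret prob_space M using X by (simp add: bounded_nat_rv_def)
  have [measurable]: "X \<in> measurable M (count_space UNIV)"
    using X by (simp add: bounded_nat_rv_def)
  define D where "D = distr M (count_space UNIV) X"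
  have int: "integral\<^sup>L D g = (\<integral>\<omega>. g (X \<omega>) \<partial>M)"
    for g :: "nat \<Rightarrow> 'b :: {banach, second_countable_topology}"
    unfolding D_def by (intro integral_distr) auto
  have rv: "bounded_nat_rv D (\<lambda>n. n)"
    using X unfolding bounded_nat_rv_def D_def
    by (auto simp: AE_distr_iff intro: prob_space_distr)
  have sd: "std_dev D (\<lambda>n. n) = std_dev M X"
    by (simp add: std_dev_def int)
  have "standardized D (\<lambda>n. n) (X \<omega>) = standardized M X \<omega>" for \<omega>
    using sd by (simp add: standardized_def int)
  then have cum: "cumulant m D (standardized D (\<lambda>n. n)) = cumulant m M (standardized M X)"
    by (simp add: cumulant_def int)
  have "\<forall>z\<in>sector \<delta>. pgf D (\<lambda>n. n) z \<noteq> 0"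
    using nz by (simp add: pgf_def int)
  moreover have "prob_space.variance D (\<lambda>n. real n) > 0"
    using var by (simp add: int)
  ultimately have "\<bar>cumulant m D (standardized D (\<lambda>n. n))\<bar>
      \<le> fact m / (c * \<delta> * std_dev D (\<lambda>n. n)) ^ (m - 2)"
    using c \<delta> m rv unfolding cumulant_bound_constant_def by blast
  then show ?thesis by (simp only: cum sd)
qed

text \<open>Transfers the result on finite exponential sums: \<open>p\<close> is the law of
  \<open>X\<close> on \<open>{..B}\<close>, and \<open>x\<close> lists the standardized values,
  which have mean 0 and second moment 1 under \<open>p\<close>.\<close>

lemma mgf_standardized:
  fixes M :: "'a measure" and X :: "'a \<Rightarrow> nat"
  defines "Y \<equiv> standardized M X"
  assumes X: "bounded_nat_rv M X"
    and var: "prob_space.variance M (\<lambda>\<omega>. real (X \<omega>)) > 0" and \<Delta>: "\<Delta> > 0"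
    and bound: "\<And>m. m \<ge> 3 \<Longrightarrow> \<bar>cumulant m M Y\<bar> \<le> fact m / \<Delta> ^ (m - 2)"
  shows "integrable M (\<lambda>\<omega>. exp (z * complex_of_real (Y \<omega>)))"
    and "cumulant 0 M Y = 0" "cumulant 1 M Y = 0" "cumulant 2 M Y = 1"
    and "\<And>z. norm z < \<Delta> \<Longrightarrow> mgf M Y z = exp (\<Sum>m. of_real (cumulant m M Y / fact m) * z ^ m)"
proof -
  interpret prob_space M using X by (simp add: bounded_nat_rv_def)
  have [measurable]: "X \<in> measurable M (count_space UNIV)"
    using X by (simp add: bounded_nat_rv_def)
  obtain B where B: "AE \<omega> in M. X \<omega> \<le> B"
    using X by (auto simp: bounded_nat_rv_def)
  define p where "p = (\<lambda>k. measure M {\<omega> \<in> space M. X \<omega> = k})"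
  define \<mu> where "\<mu> = (\<integral>\<omega>. real (X \<omega>) \<partial>M)"
  define \<sigma> where "\<sigma> = std_dev M X"
  define x where "x = (\<lambda>k. (real k - \<mu>) / \<sigma>)"
  have hbi: "has_bochner_integral M (\<lambda>\<omega>. g (X \<omega>)) (\<Sum>k\<le>B. p k *\<^sub>R g k)"
    for g :: "nat \<Rightarrow> 'b :: {banach, second_countable_topology}"
    unfolding p_def by (intro has_bochner_integral_bounded_nat_rv B prob_space_axioms) auto
  have Y: "Y \<omega> = x (X \<omega>)" for \<omega>
    by (simp add: Y_def standardized_def x_def \<mu>_def \<sigma>_def)
  have \<sigma>: "\<sigma> > 0" "\<sigma>\<^sup>2 = (\<integral>\<omega>. (real (X \<omega>) - \<mu>)\<^sup>2 \<partial>M)"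
    using var by (auto simp: \<sigma>_def std_dev_def \<mu>_def)
  have p1: "sum p {..B} = 1"
    using has_bochner_integral_integral_eq[OF hbi[of "\<lambda>_. 1::real"]] by (simp add: prob_space)
  have \<mu>: "(\<Sum>k\<le>B. p k * real k) = \<mu>"
    using has_bochner_integral_integral_eq[OF hbi[of real]] by (simp add: \<mu>_def)
  have mean: "(\<Sum>k\<le>B. p k * x k) = 0"
    using p1 \<mu> by (simp add: x_def right_diff_distrib sum_subtractf flip: sum_divide_distrib sum_distrib_right)
  have "(\<Sum>k\<le>B. p k * (real k - \<mu>)\<^sup>2) = \<sigma>\<^sup>2"
    using has_bochner_integral_integral_eq[OF hbi[of "\<lambda>k. (real k - \<mu>)\<^sup>2"]] by (simp add: \<sigma>(2))
  then have sq: "(\<Sum>k\<le>B. p k * (x k)\<^sup>2) = 1"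
    using \<sigma>(1) by (simp add: x_def power_divide flip: sum_divide_distrib)
  have cum: "cumulant m M Y = (deriv ^^ m) (\<lambda>t::real. ln (\<Sum>k\<le>B. p k * exp (t * x k))) 0" for m
    using has_bochner_integral_integral_eq[OF hbi[of "\<lambda>k. exp (t * x k)" for t]]
    by (simp add: cumulant_def Y)
  have mgf: "mgf M Y z = (\<Sum>k\<le>B. of_real (p k) * exp (z * of_real (x k)))" for z
    using has_bochner_integral_integral_eq[OF hbi[of "\<lambda>k. exp (z * of_real (x k))"]]
    by (simp add: mgf_def Y scaleR_conv_of_real)
  show "integrable M (\<lambda>\<omega>. exp (z * complex_of_real (Y \<omega>)))"
    unfolding Y by (rule integrable.intros[OF hbi[of "\<lambda>k. exp (z * of_real (x k))"]])
  \<comment> \<open>Folding with \<open>cum\<close> turns the iterated derivatives into cumulants of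
    \<open>Y\<close>; what stays open is that the weights \<open>p\<close> are nonnegative.\<close>
  note * = exp_sum_eq_exp_cumulant_series[of "{..B}" p x \<Delta>, folded cum,
      OF finite_atMost _ p1 mean sq \<Delta> bound]
  show "cumulant 0 M Y = 0" "cumulant 1 M Y = 0" "cumulant 2 M Y = 1"
    by (rule *; simp add: p_def)+
  show "mgf M Y z = exp (\<Sum>m. of_real (cumulant m M Y / fact m) * z ^ m)" if "norm z < \<Delta>" for z
    unfolding mgf by (rule *) (use that in \<open>simp_all add: p_def\<close>)
qed

section \<open>Mod-Gaussian convergence of the rescaled variables\<close>

text \<open>Scaling the variable by \<open>s N\<close> amounts to scaling the argument of its moment
  generating function, so with \<open>t N = (s N)\<^sup>2\<close> the convergence is that of the
  rescaled cumulant series. The limit is an exponential, hence free of zeros.\<close>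

lemma mod_gaussian_convergence_scaled:
  fixes M :: "nat \<Rightarrow> 'a measure" and X :: "nat \<Rightarrow> 'a \<Rightarrow> nat"
  defines "Y \<equiv> (\<lambda>N. standardized (M N) (X N))"
  assumes X: "\<And>N. N \<ge> 1 \<Longrightarrow> bounded_nat_rv (M N) (X N)"
    and var: "\<And>N. N \<ge> 1 \<Longrightarrow> prob_space.variance (M N) (\<lambda>\<omega>. real (X N \<omega>)) > 0"
    and \<Delta>: "\<And>N. N \<ge> 1 \<Longrightarrow> \<Delta> N > 0"
    and bound: "\<And>N m. N \<ge> 1 \<Longrightarrow> m \<ge> 3 \<Longrightarrow> \<bar>cumulant m (M N) (Y N)\<bar> \<le> fact m / \<Delta> N ^ (m - 2)"
    and j: "j \<ge> 3"
    and vanish: "\<And>N m. N \<ge> 1 \<Longrightarrow> 3 \<le> m \<Longrightarrow> m < j \<Longrightarrow> cumulant m (M N) (Y N) = 0"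
    and L: "(\<lambda>N. cumulant j (M N) (Y N) * s N ^ j) \<longlonglongrightarrow> L"
    and s: "\<And>N. N \<ge> 1 \<Longrightarrow> s N \<ge> 0" "\<And>N. N \<ge> 1 \<Longrightarrow> t N = (s N)\<^sup>2"
    and t: "filterlim t at_top sequentially"
    and lim0: "(\<lambda>N. s N / \<Delta> N) \<longlonglongrightarrow> 0"
    and lim1: "(\<lambda>N. (\<Delta> N)\<^sup>2 * (s N / \<Delta> N) ^ Suc j) \<longlonglongrightarrow> 0"
  shows "mod_gaussian_convergence M (\<lambda>N \<omega>. s N * Y N \<omega>) t (\<lambda>z. exp (of_real L * z ^ j / fact j))"
  unfolding mod_gaussian_convergence_def
proof (intro conjI allI impI)
  have std: "integrable (M N) (\<lambda>\<omega>. exp (z * complex_of_real (Y N \<omega>)))"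
      "cumulant 0 (M N) (Y N) = 0" "cumulant 1 (M N) (Y N) = 0" "cumulant 2 (M N) (Y N) = 1"
      "norm z < \<Delta> N \<Longrightarrow>
         mgf (M N) (Y N) z = exp (\<Sum>m. of_real (cumulant m (M N) (Y N) / fact m) * z ^ m)"
    if "N \<ge> 1" for N z
    unfolding Y_def using that bound
    by (intro mgf_standardized[of "M N" "X N" "\<Delta> N"]; simp add: X var \<Delta> Y_def)+
  show "(\<lambda>z. exp (complex_of_real L * z ^ j / fact j)) analytic_on UNIV"
    by (intro analytic_intros) auto
  show "integrable (M N) (\<lambda>\<omega>. exp (z * complex_of_real (s N * Y N \<omega>)))" if "N \<ge> 1" for N z
    using std(1)[OF that, of "z * of_real (s N)"] by (simp add: mult_ac)
  show "\<exists>r>0. uniform_limit (ball z0 r)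
        (\<lambda>N z. mgf (M N) (\<lambda>\<omega>. s N * Y N \<omega>) z * exp (- of_real (t N) * z\<^sup>2 / 2))
        (\<lambda>z. exp (of_real L * z ^ j / fact j)) sequentially" for z0
  proof (intro exI conjI)
    \<comment> \<open>The radius 1 is arbitrary, since the limit is uniform on every ball.\<close>
    have ul: "uniform_limit (ball z0 1)
           (\<lambda>N z. mgf (M N) (Y N) (z * of_real (s N)) * exp (- of_real ((s N)\<^sup>2) * z\<^sup>2 / 2))
           (\<lambda>z. exp (of_real L * z ^ j / fact j)) sequentially"
      by (rule uniform_limit_scaled_exp_series
            [where \<kappa> = "\<lambda>N m. cumulant m (M N) (Y N)" and \<Delta> = \<Delta>])
         (fact std(2-5) bound vanish j L \<Delta> s(1) lim0 lim1 | assumption)+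
    have "\<forall>\<^sub>F N in sequentially. \<forall>z\<in>ball z0 1.
        mgf (M N) (Y N) (z * of_real (s N)) * exp (- of_real ((s N)\<^sup>2) * z\<^sup>2 / 2) =
        mgf (M N) (\<lambda>\<omega>. s N * Y N \<omega>) z * exp (- of_real (t N) * z\<^sup>2 / 2)"
      using eventually_ge_at_top[of 1]
      by eventually_elim (simp add: s mgf_def mult_ac)
    from iffD1[OF uniform_limit_cong[OF this refl] ul]
    show "uniform_limit (ball z0 1)
        (\<lambda>N z. mgf (M N) (\<lambda>\<omega>. s N * Y N \<omega>) z * exp (- of_real (t N) * z\<^sup>2 / 2))
        (\<lambda>z. exp (of_real L * z ^ j / fact j)) sequentially" .
  qed simp
qed (use t in auto)

theorem corollary2p4:
  fixes M :: "nat \<Rightarrow> 'a measure" and X :: "nat \<Rightarrow> 'a \<Rightarrow> nat"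
    and \<delta> \<Delta> :: "nat \<Rightarrow> real" and c :: real
  assumes c: "cumulant_bound_constant c"
    and rv: "\<And>N. N \<ge> 1 \<Longrightarrow> bounded_nat_rv (M N) (X N)"
    and var_pos: "\<And>N. N \<ge> 1 \<Longrightarrow> prob_space.variance (M N) (\<lambda>\<omega>. real (X N \<omega>)) > 0"
    and delta: "\<And>N. N \<ge> 1 \<Longrightarrow> 0 < \<delta> N \<and> \<delta> N \<le> pi"
    and no_roots: "\<And>N z. N \<ge> 1 \<Longrightarrow> z \<in> sector (\<delta> N) \<Longrightarrow> pgf (M N) (X N) z \<noteq> 0"
    and Delta: "\<And>N. N \<ge> 1 \<Longrightarrow> \<Delta> N = c * \<delta> N * std_dev (M N) (X N)"
    and Delta_lim: "filterlim \<Delta> at_top sequentially"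
  shows "(\<forall>L::real.
            (\<lambda>N. cumulant 3 (M N) (standardized (M N) (X N)) * \<Delta> N) \<longlonglongrightarrow> L \<longrightarrow>
            mod_gaussian_convergence M
              (\<lambda>N \<omega>. \<Delta> N powr (1 / 3) * standardized (M N) (X N) \<omega>)
              (\<lambda>N. \<Delta> N powr (2 / 3))
              (\<lambda>z. exp (of_real L * z ^ 3 / 6))) \<and>
         (\<forall>L::real.
            (\<forall>N\<ge>1. cumulant 3 (M N) (standardized (M N) (X N)) = 0) \<longrightarrow>
            (\<lambda>N. cumulant 4 (M N) (standardized (M N) (X N)) * (\<Delta> N)\<^sup>2) \<longlonglongrightarrow> L \<longrightarrow>
            mod_gaussian_convergence M
              (\<lambda>N \<omega>. sqrt (\<Delta> N) * standardized (M N) (X N) \<omega>)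
              \<Delta>
              (\<lambda>z. exp (of_real L * z ^ 4 / 24)))"
proof (intro conjI allI impI)
  have pos: "\<Delta> N > 0" if "N \<ge> 1" for N
    using c delta[OF that] var_pos[OF that]
    by (simp add: Delta[OF that] cumulant_bound_constant_def std_dev_def)
  have bound: "\<bar>cumulant m (M N) (standardized (M N) (X N))\<bar> \<le> fact m / \<Delta> N ^ (m - 2)"
    if "N \<ge> 1" "m \<ge> 3" for N m
    unfolding Delta[OF that(1)] using that delta
    by (intro cumulant_bound_any_sample_space c rv var_pos no_roots) auto
  have ev: "\<forall>\<^sub>F N in sequentially. \<Delta> N > 0"
    using eventually_ge_at_top[of 1] by eventually_elim (rule pos)
  have fact34: "fact 3 = (6::complex)" "fact 4 = (24::complex)"
    by (simp_all add: fact_numeral)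
  {
    fix L assume L: "(\<lambda>N. cumulant 3 (M N) (standardized (M N) (X N)) * \<Delta> N) \<longlonglongrightarrow> L"
    have cube: "(x powr (1 / 3)) ^ 3 = x" if "x > 0" for x :: real
      using that by (simp add: powr_power)
    have "mod_gaussian_convergence M
              (\<lambda>N \<omega>. \<Delta> N powr (1 / 3) * standardized (M N) (X N) \<omega>)
              (\<lambda>N. \<Delta> N powr (2 / 3)) (\<lambda>z. exp (of_real L * z ^ 3 / fact 3))"
    proof (rule mod_gaussian_convergence_scaled[OF rv var_pos pos bound])
      show "(\<lambda>N. cumulant 3 (M N) (standardized (M N) (X N)) * (\<Delta> N powr (1 / 3)) ^ 3) \<longlonglongrightarrow> L"
        \<comment> \<open>The identity holds only eventually, because the hypotheses say nothing
          about \<open>\<Delta> 0\<close>.\<close>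
        by (rule Lim_transform_eventually[OF L]) (use ev in eventually_elim, simp add: cube)
      show "\<Delta> N powr (2 / 3) = (\<Delta> N powr (1 / 3))\<^sup>2" if "N \<ge> 1" for N
        using pos[OF that] by (simp add: powr_power)
      have "filterlim (\<lambda>x::real. x powr (2 / 3)) at_top at_top" by real_asymp
      then show "filterlim (\<lambda>N. \<Delta> N powr (2 / 3)) at_top sequentially"
        using Delta_lim by (rule filterlim_compose)
      have "((\<lambda>x::real. x powr (1 / 3) / x) \<longlongrightarrow> 0) at_top" by real_asymp
      then show "(\<lambda>N. \<Delta> N powr (1 / 3) / \<Delta> N) \<longlonglongrightarrow> 0"
        using Delta_lim by (rule filterlim_compose)
      \<comment> \<open>Here \<open>s / \<Delta>\<close> has order \<Delta> to the power -2/3, so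
        the tail has order 2 - 8/3 = -2/3.\<close>
      have "((\<lambda>x::real. x\<^sup>2 * (x powr (1 / 3) / x) ^ 4) \<longlongrightarrow> 0) at_top" by real_asymp
      then have "((\<lambda>x::real. x\<^sup>2 * (x powr (1 / 3) / x) ^ Suc 3) \<longlongrightarrow> 0) at_top" by simp
      then show "(\<lambda>N. (\<Delta> N)\<^sup>2 * (\<Delta> N powr (1 / 3) / \<Delta> N) ^ Suc 3) \<longlonglongrightarrow> 0"
        using Delta_lim by (rule filterlim_compose)
    \<comment> \<open>The vanishing condition is empty for \<open>j = 3\<close>.\<close>
    qed auto
    then show "mod_gaussian_convergence M
              (\<lambda>N \<omega>. \<Delta> N powr (1 / 3) * standardized (M N) (X N) \<omega>)
              (\<lambda>N. \<Delta> N powr (2 / 3)) (\<lambda>z. exp (of_real L * z ^ 3 / 6))"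
      by (simp only: fact34)
  next
    fix L assume k3: "\<forall>N\<ge>1. cumulant 3 (M N) (standardized (M N) (X N)) = 0"
      and L: "(\<lambda>N. cumulant 4 (M N) (standardized (M N) (X N)) * (\<Delta> N)\<^sup>2) \<longlonglongrightarrow> L"
    have sqrt4: "sqrt x ^ 4 = x\<^sup>2" if "x > 0" for x :: real
      using that by (simp add: power4_eq_xxxx power2_eq_square)
    have "mod_gaussian_convergence M
              (\<lambda>N \<omega>. sqrt (\<Delta> N) * standardized (M N) (X N) \<omega>)
              \<Delta> (\<lambda>z. exp (of_real L * z ^ 4 / fact 4))"
    proof (rule mod_gaussian_convergence_scaled[OF rv var_pos pos bound])
      show "(\<lambda>N. cumulant 4 (M N) (standardized (M N) (X N)) * sqrt (\<Delta> N) ^ 4) \<longlonglongrightarrow> L"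
        by (rule Lim_transform_eventually[OF L]) (use ev in eventually_elim, simp add: sqrt4)
      show "\<Delta> N = (sqrt (\<Delta> N))\<^sup>2" if "N \<ge> 1" for N
        using pos[OF that] by simp
      have "((\<lambda>x::real. sqrt x / x) \<longlongrightarrow> 0) at_top" by real_asymp
      then show "(\<lambda>N. sqrt (\<Delta> N) / \<Delta> N) \<longlonglongrightarrow> 0"
        using Delta_lim by (rule filterlim_compose)
      \<comment> \<open>Here \<open>s / \<Delta>\<close> has order \<Delta> to the power -1/2. The
        tail starts at order 5 and has order 2 - 5/2 = -1/2; starting at order 4 it would only be
        bounded.\<close>
      have "((\<lambda>x::real. x\<^sup>2 * (sqrt x / x) ^ 5) \<longlongrightarrow> 0) at_top" by real_asymp
      then have "((\<lambda>x::real. x\<^sup>2 * (sqrt x / x) ^ Suc 4) \<longlongrightarrow> 0) at_top" by simp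
      then show "(\<lambda>N. (\<Delta> N)\<^sup>2 * (sqrt (\<Delta> N) / \<Delta> N) ^ Suc 4) \<longlonglongrightarrow> 0"
        using Delta_lim by (rule filterlim_compose)
      show "cumulant m (M N) (standardized (M N) (X N)) = 0" if "N \<ge> 1" "3 \<le> m" "m < 4" for N m
      proof -
        have "m = 3" using that by simp
        with k3 that(1) show ?thesis by blast
      qed
      show "0 \<le> sqrt (\<Delta> N)" if "N \<ge> 1" for N
        using pos[OF that] by simp
    qed (auto simp: Delta_lim)
    then show "mod_gaussian_convergence M
              (\<lambda>N \<omega>. sqrt (\<Delta> N) * standardized (M N) (X N) \<omega>)
              \<Delta> (\<lambda>z. exp (of_real L * z ^ 4 / 24))"
      by (simp only: fact34)
  }
qed

end
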